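(* The monoidal category $(\mathsf{SDS},\times,\mathcal I)$ of weighted dual skeletons is graded by the multiplicative group $\mathbb R_{>0}$ via the degree map $\deg$; specifically: (1) the tensor product sends objects of degrees $K_1$ and $K_2$ to an object of degree $K_1K_2$, i.e. $\times:\mathsf{SDS}_{K_1}\times\mathsf{SDS}_{K_2}\to\mathsf{SDS}_{K_1K_2}$; (2) morphisms preserve degree (if there is a morphism $\mathcal E_1\to\mathcal E_2$ then $\deg(\mathcal E_1)=\deg(\mathcal E_2)$), so the bifunctor $\times$ respects the grading; (3) the unit $\mathcal I$ has degree $1$.
   Context: A weighted dual skeleton is a triple $\mathcal E=(Z,\sigma,\kappa)$ where $Z$ is a non-empty finite set, $\sigma:Z\to Z$ satisfies $\sigma^2=\mathrm{id}$, and $\kappa:Z\to\mathbb R_{>0}$ satisfies $\kappa(z)\kappa(\sigma(z))=K$ for all $z\in Z$, with $K>0$ constant. The number $K=\deg(\mathcal E)$ is the degree. A morphism $\phi:(Z_1,\sigma_1,\kappa_1)\to(Z_2,\sigma_2,\kappa_2)$ is a map $\phi:Z_1\to Z_2$ with $\phi(\sigma_1(z))=\sigma_2(\phi(z))$ and $\kappa_1(z)=\kappa_2(\phi(z))$ for all $z\in Z_1$. These form the category $\mathsf{SDS}$ (composition and identities of maps); $\mathsf{SDS}_K$ is the full subcategory of skeletons of degree $K$. The Cartesian product is $\mathcal E_1\times\mathcal E_2=(Z_1\times Z_2,\sigma_1\times\sigma_2,\kappa_1\otimes\kappa_2)$ with $(\sigma_1\times\sigma_2)(z,w)=(\sigma_1(z),\sigma_2(w))$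 and $(\kappa_1\otimes\kappa_2)(z,w)=\kappa_1(z)\kappa_2(w)$; on morphisms $(\phi_1\times\phi_2)(z,w)=(\phi_1(z),\phi_2(w))$. The unit $\mathcal I$ is the skeleton with a single site (a fixed point) with weight $\kappa=1$. With the canonical set bijections as structure isomorphisms, $(\mathsf{SDS},\times,\mathcal I)$ is a symmetric monoidal category. *)

theory Defs
  imports Complex_Main "HOL-Library.FuncSet"
begin

section \<open>Weighted dual skeletons\<close>

record 'a skeleton =
  sites :: "'a set"
  invol :: "'a \<Rightarrow> 'a"
  weight :: "'a \<Rightarrow> real"

text \<open>
  The structure maps, and below the morphisms, are maps on the set of sites; they are represented
  by total functions that are \<^const>\<open>undefined\<close> elsewhere. HOL equality is therefore
  the intended equality, on skeletons as well as on morphisms.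
\<close>

definition has_degree :: "'a skeleton \<Rightarrow> real \<Rightarrow> bool" where
  "has_degree E K \<longleftrightarrow> K > 0 \<and> (\<forall>z\<in>sites E. weight E z * weight E (invol E z) = K)"

definition SDS :: "'a skeleton set" where
  "SDS = {E. finite (sites E) \<and> sites E \<noteq> {} \<and>
             invol E \<in> sites E \<rightarrow>\<^sub>E sites E \<and> (\<forall>z\<in>sites E. invol E (invol E z) = z) \<and>
             weight E \<in> sites E \<rightarrow>\<^sub>E {0<..} \<and>
             (\<exists>K. has_degree E K)}"

definition degree :: "'a skeleton \<Rightarrow> real" where
  "degree E = (THE K. has_degree E K)"

definition SDS_deg :: "real \<Rightarrow> 'a skeleton set" where
  "SDS_deg K = {E \<in> SDS. degree E = K}"

lemma has_degree_unique:
  assumes "E \<in> SDS" "has_degree E K" "has_degree E L"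
  shows "K = L"
proof -
  obtain z where "z \<in> sites E" using assms(1) by (auto simp: SDS_def)
  then show ?thesis using assms(2,3) by (auto simp: has_degree_def)
qed

lemma degree_eqI:
  assumes "E \<in> SDS" "has_degree E K"
  shows "degree E = K"
  unfolding degree_def using assms has_degree_unique by blast


section \<open>The category of skeletons\<close>

text \<open>
  Sites may live in different types, so that source and target of a morphism need not have the
  same type. The subcategory of skeletons of a fixed degree is full: its morphisms are again
  given by \<open>hom\<close>.
\<close>

definition hom :: "'a skeleton \<Rightarrow> 'b skeleton \<Rightarrow> ('a \<Rightarrow> 'b) set" where
  "hom E F = {\<phi> \<in> sites E \<rightarrow>\<^sub>E sites F.
     \<forall>z\<in>sites E. \<phi> (invol E z) = invol F (\<phi> z) \<and> weight E z = weight F (\<phi> z)}"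

definition id_mor :: "'a skeleton \<Rightarrow> 'a \<Rightarrow> 'a" where
  "id_mor E = (\<lambda>z\<in>sites E. z)"

text \<open>Composition \<open>\<psi> \<circ> \<phi>\<close> of morphisms with source \<open>E\<close> of \<open>\<phi>\<close>.\<close>

definition comp_mor :: "'a skeleton \<Rightarrow> ('b \<Rightarrow> 'c) \<Rightarrow> ('a \<Rightarrow> 'b) \<Rightarrow> 'a \<Rightarrow> 'c" where
  "comp_mor E \<psi> \<phi> = compose (sites E) \<psi> \<phi>"

definition iso_mor :: "'a skeleton \<Rightarrow> 'b skeleton \<Rightarrow> ('a \<Rightarrow> 'b) set" where
  "iso_mor E F = {\<phi> \<in> hom E F. \<exists>\<psi>\<in>hom F E. comp_mor E \<psi> \<phi> = id_mor E \<and> comp_mor F \<phi> \<psi> = id_mor F}"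

lemma hom_closed: "\<phi> \<in> hom E F \<Longrightarrow> z \<in> sites E \<Longrightarrow> \<phi> z \<in> sites F"
  and hom_ext: "\<phi> \<in> hom E F \<Longrightarrow> \<phi> \<in> extensional (sites E)"
  by (auto simp: hom_def PiE_def)

lemma invol_closed: "E \<in> SDS \<Longrightarrow> z \<in> sites E \<Longrightarrow> invol E z \<in> sites E"
  by (auto simp: SDS_def PiE_def)

lemma id_mor_hom: "E \<in> SDS \<Longrightarrow> id_mor E \<in> hom E E"
  by (auto simp: hom_def id_mor_def invol_closed)

lemma comp_mor_hom:
  "E \<in> SDS \<Longrightarrow> \<phi> \<in> hom E F \<Longrightarrow> \<psi> \<in> hom F G \<Longrightarrow> comp_mor E \<psi> \<phi> \<in> hom E G"
  by (auto simp: hom_def comp_mor_def compose_def invol_closed PiE_mem)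

lemma comp_mor_assoc:
  "\<phi> \<in> hom E F \<Longrightarrow> comp_mor E \<chi> (comp_mor E \<psi> \<phi>) = comp_mor E (comp_mor F \<chi> \<psi>) \<phi>"
  by (auto simp: comp_mor_def compose_def hom_closed)

lemma comp_id_mor:
  assumes "\<phi> \<in> hom E F"
  shows "comp_mor E \<phi> (id_mor E) = \<phi>" "comp_mor E (id_mor F) \<phi> = \<phi>"
  using extensional_arb[OF hom_ext[OF assms]] hom_closed[OF assms]
  by (auto simp: fun_eq_iff comp_mor_def compose_def id_mor_def)


section \<open>The Cartesian product\<close>

definition prod_skel :: "'a skeleton \<Rightarrow> 'b skeleton \<Rightarrow> ('a \<times> 'b) skeleton"  (infixr "\<times>\<^sub>S" 80) where
  "E \<times>\<^sub>S F = \<lparr> sites = sites E \<times> sites F,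
             invol = (\<lambda>(z, w)\<in>sites E \<times> sites F. (invol E z, invol F w)),
             weight = (\<lambda>(z, w)\<in>sites E \<times> sites F. weight E z * weight F w) \<rparr>"

text \<open>
  The product of morphisms \<open>\<phi>\<close> with source \<open>E\<close> and \<open>\<psi>\<close> with source \<open>F\<close>.
\<close>

definition prod_mor ::
  "'a skeleton \<Rightarrow> 'c skeleton \<Rightarrow> ('a \<Rightarrow> 'b) \<Rightarrow> ('c \<Rightarrow> 'd) \<Rightarrow> 'a \<times> 'c \<Rightarrow> 'b \<times> 'd" where
  "prod_mor E F \<phi> \<psi> = (\<lambda>(z, w)\<in>sites E \<times> sites F. (\<phi> z, \<psi> w))"

definition unit_skel :: "unit skeleton" where
  "unit_skel = \<lparr> sites = {()}, invol = (\<lambda>_. ()), weight = (\<lambda>_. 1) \<rparr>"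


section \<open>The symmetric monoidal structure\<close>

definition assoc_mor ::
  "'a skeleton \<Rightarrow> 'b skeleton \<Rightarrow> 'c skeleton \<Rightarrow> ('a \<times> 'b) \<times> 'c \<Rightarrow> 'a \<times> 'b \<times> 'c" where
  "assoc_mor E F G = (\<lambda>((x, y), z)\<in>(sites E \<times> sites F) \<times> sites G. (x, y, z))"

definition lunit_mor :: "'a skeleton \<Rightarrow> unit \<times> 'a \<Rightarrow> 'a" where
  "lunit_mor E = (\<lambda>(u, z)\<in>{()} \<times> sites E. z)"

definition runit_mor :: "'a skeleton \<Rightarrow> 'a \<times> unit \<Rightarrow> 'a" where
  "runit_mor E = (\<lambda>(z, u)\<in>sites E \<times> {()}. z)"

definition swap_mor :: "'a skeleton \<Rightarrow> 'b skeleton \<Rightarrow> 'a \<times> 'b \<Rightarrow> 'b \<times> 'a" where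
  "swap_mor E F = (\<lambda>(x, y)\<in>sites E \<times> sites F. (y, x))"

lemma sites_prod [simp]: "sites (E \<times>\<^sub>S F) = sites E \<times> sites F"
  by (simp add: prod_skel_def)

lemma sites_unit [simp]: "sites unit_skel = {()}"
  by (simp add: unit_skel_def)

lemmas structure_mor_defs =
  assoc_mor_def lunit_mor_def runit_mor_def swap_mor_def prod_mor_def id_mor_def

lemma iso_morI:
  assumes "E \<in> SDS" "\<phi> \<in> hom E F" "bij_betw \<phi> (sites E) (sites F)"
  shows "\<phi> \<in> iso_mor E F"
proof -
  define \<psi> where "\<psi> = (\<lambda>y\<in>sites F. inv_into (sites E) \<phi> y)"
  have inj: "inj_on \<phi> (sites E)" and im: "\<phi> ` sites E = sites F"
    using assms(3) by (auto simp: bij_betw_def)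
  have l: "\<psi> (\<phi> z) = z" if "z \<in> sites E" for z
    using that inj im by (auto simp: \<psi>_def)
  have r: "\<psi> y \<in> sites E" "\<phi> (\<psi> y) = y" if "y \<in> sites F" for y
    using that im by (simp_all add: \<psi>_def inv_into_into f_inv_into_f)
  have "\<psi> \<in> sites F \<rightarrow>\<^sub>E sites E"
    using r(1) by (simp add: \<psi>_def PiE_def Pi_def)
  moreover have "\<psi> (invol F y) = invol E (\<psi> y) \<and> weight F y = weight E (\<psi> y)" if "y \<in> sites F" for y
  proof -
    define z where "z = \<psi> y"
    have z: "z \<in> sites E" "y = \<phi> z" using r[OF that] by (simp_all add: z_def)
    then have "invol F y = \<phi> (invol E z)" "weight F y = weight E z"
      using assms(2) by (auto simp: hom_def)
    then show ?thesis using z l invol_closed[OF assms(1) z(1)] by simp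
  qed
  ultimately have "\<psi> \<in> hom F E" by (auto simp: hom_def)
  moreover have "comp_mor E \<psi> \<phi> = id_mor E"
    using l by (auto simp: comp_mor_def compose_def id_mor_def)
  moreover have "comp_mor F \<phi> \<psi> = id_mor F"
    using r by (auto simp: comp_mor_def compose_def id_mor_def)
  ultimately show ?thesis using assms(2) by (auto simp: iso_mor_def)
qed

lemma has_degree_prod:
  assumes "E \<in> SDS" "F \<in> SDS" "has_degree E K" "has_degree F L"
  shows "has_degree (E \<times>\<^sub>S F) (K * L)"
  unfolding has_degree_def
proof (intro conjI ballI)
  show "K * L > 0" using assms(3,4) by (simp add: has_degree_def)
next
  fix p assume "p \<in> sites (E \<times>\<^sub>S F)"
  then obtain z w where p: "p = (z, w)" "z \<in> sites E" "w \<in> sites F" by auto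
  have "weight E z * weight E (invol E z) = K" "weight F w * weight F (invol F w) = L"
    using assms p by (auto simp: has_degree_def)
  then have "(weight E z * weight F w) * (weight E (invol E z) * weight F (invol F w)) = K * L"
    by (metis mult.assoc mult.left_commute)
  then show "weight (E \<times>\<^sub>S F) p * weight (E \<times>\<^sub>S F) (invol (E \<times>\<^sub>S F) p) = K * L"
    using p assms(1,2) by (simp add: prod_skel_def invol_closed)
qed

lemma prod_SDS:
  assumes "E \<in> SDS" "F \<in> SDS"
  shows "E \<times>\<^sub>S F \<in> SDS"
proof -
  obtain K L where "has_degree E K" "has_degree F L" using assms by (auto simp: SDS_def)
  then have "\<exists>K. has_degree (E \<times>\<^sub>S F) K" using has_degree_prod[OF assms] by blast
  moreover have "invol E (invol E z) = z" "weight E z > 0" if "z \<in> sites E" for z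
    using assms(1) that by (auto simp: SDS_def PiE_mem)
  moreover have "invol F (invol F z) = z" "weight F z > 0" if "z \<in> sites F" for z
    using assms(2) that by (auto simp: SDS_def PiE_mem)
  moreover have "finite (sites E \<times> sites F)" "sites E \<times> sites F \<noteq> {}"
    using assms by (auto simp: SDS_def)
  ultimately show ?thesis
    unfolding SDS_def
    by (simp add: prod_skel_def PiE_def Pi_def split_beta invol_closed[OF assms(1)]
          invol_closed[OF assms(2)])
qed

lemma unit_SDS: "unit_skel \<in> SDS"
  by (auto simp: SDS_def unit_skel_def has_degree_def PiE_def extensional_def)

lemma assoc_iso:
  assumes "E \<in> SDS" "F \<in> SDS" "G \<in> SDS"
  shows "assoc_mor E F G \<in> iso_mor ((E \<times>\<^sub>S F) \<times>\<^sub>S G) (E \<times>\<^sub>S F \<times>\<^sub>S G)"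
proof (rule iso_morI)
  show "(E \<times>\<^sub>S F) \<times>\<^sub>S G \<in> SDS" using assms by (intro prod_SDS unit_SDS)
qed (auto simp: hom_def assoc_mor_def prod_skel_def unit_skel_def assms invol_closed mult.assoc
       bij_betw_def inj_on_def image_iff)

lemma lunit_iso:
  assumes "E \<in> SDS"
  shows "lunit_mor E \<in> iso_mor (unit_skel \<times>\<^sub>S E) E"
proof (rule iso_morI)
  show "unit_skel \<times>\<^sub>S E \<in> SDS" using assms by (intro prod_SDS unit_SDS)
qed (auto simp: hom_def lunit_mor_def prod_skel_def unit_skel_def assms invol_closed mult.assoc
       bij_betw_def inj_on_def image_iff)

lemma runit_iso:
  assumes "E \<in> SDS"
  shows "runit_mor E \<in> iso_mor (E \<times>\<^sub>S unit_skel) E"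
proof (rule iso_morI)
  show "E \<times>\<^sub>S unit_skel \<in> SDS" using assms by (intro prod_SDS unit_SDS)
qed (auto simp: hom_def runit_mor_def prod_skel_def unit_skel_def assms invol_closed mult.assoc
       bij_betw_def inj_on_def image_iff)

lemma swap_iso:
  assumes "E \<in> SDS" "F \<in> SDS"
  shows "swap_mor E F \<in> iso_mor (E \<times>\<^sub>S F) (F \<times>\<^sub>S E)"
proof (rule iso_morI)
  show "E \<times>\<^sub>S F \<in> SDS" using assms by (intro prod_SDS unit_SDS)
qed (auto simp: hom_def swap_mor_def prod_skel_def unit_skel_def assms invol_closed mult.assoc
       bij_betw_def inj_on_def image_iff)

lemma assoc_natural:
  assumes "\<phi> \<in> hom E E'" "\<psi> \<in> hom F F'" "\<chi> \<in> hom G G'"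
  shows "comp_mor ((E \<times>\<^sub>S F) \<times>\<^sub>S G) (assoc_mor E' F' G') (prod_mor (E \<times>\<^sub>S F) G (prod_mor E F \<phi> \<psi>) \<chi>) =
         comp_mor ((E \<times>\<^sub>S F) \<times>\<^sub>S G) (prod_mor E (F \<times>\<^sub>S G) \<phi> (prod_mor F G \<psi> \<chi>)) (assoc_mor E F G)"
  using assms by (auto simp: comp_mor_def compose_def structure_mor_defs hom_closed fun_eq_iff)

lemma lunit_natural:
  "\<phi> \<in> hom E F \<Longrightarrow>
   comp_mor (unit_skel \<times>\<^sub>S E) (lunit_mor F) (prod_mor unit_skel E (id_mor unit_skel) \<phi>) =
   comp_mor (unit_skel \<times>\<^sub>S E) \<phi> (lunit_mor E)"
  by (auto simp: comp_mor_def compose_def structure_mor_defs hom_closed fun_eq_iff)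

lemma runit_natural:
  "\<phi> \<in> hom E F \<Longrightarrow>
   comp_mor (E \<times>\<^sub>S unit_skel) (runit_mor F) (prod_mor E unit_skel \<phi> (id_mor unit_skel)) =
   comp_mor (E \<times>\<^sub>S unit_skel) \<phi> (runit_mor E)"
  by (auto simp: comp_mor_def compose_def structure_mor_defs hom_closed fun_eq_iff)

lemma swap_natural:
  "\<phi> \<in> hom E E' \<Longrightarrow> \<psi> \<in> hom F F' \<Longrightarrow>
   comp_mor (E \<times>\<^sub>S F) (swap_mor E' F') (prod_mor E F \<phi> \<psi>) =
   comp_mor (E \<times>\<^sub>S F) (prod_mor F E \<psi> \<phi>) (swap_mor E F)"
  by (auto simp: comp_mor_def compose_def structure_mor_defs hom_closed fun_eq_iff)

lemma pentagon:
  "comp_mor (((A \<times>\<^sub>S B) \<times>\<^sub>S C) \<times>\<^sub>S D) (assoc_mor A B (C \<times>\<^sub>S D)) (assoc_mor (A \<times>\<^sub>S B) C D) =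
   comp_mor (((A \<times>\<^sub>S B) \<times>\<^sub>S C) \<times>\<^sub>S D) (prod_mor A ((B \<times>\<^sub>S C) \<times>\<^sub>S D) (id_mor A) (assoc_mor B C D))
     (comp_mor (((A \<times>\<^sub>S B) \<times>\<^sub>S C) \<times>\<^sub>S D) (assoc_mor A (B \<times>\<^sub>S C) D)
        (prod_mor ((A \<times>\<^sub>S B) \<times>\<^sub>S C) D (assoc_mor A B C) (id_mor D)))"
  by (auto simp: comp_mor_def compose_def structure_mor_defs fun_eq_iff)

lemma triangle:
  "comp_mor ((A \<times>\<^sub>S unit_skel) \<times>\<^sub>S B) (prod_mor A (unit_skel \<times>\<^sub>S B) (id_mor A) (lunit_mor B))
     (assoc_mor A unit_skel B) =
   prod_mor (A \<times>\<^sub>S unit_skel) B (runit_mor A) (id_mor B)"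
  by (auto simp: comp_mor_def compose_def structure_mor_defs fun_eq_iff)

lemma symmetry: "comp_mor (A \<times>\<^sub>S B) (swap_mor B A) (swap_mor A B) = id_mor (A \<times>\<^sub>S B)"
  by (auto simp: comp_mor_def compose_def structure_mor_defs fun_eq_iff)

lemma hexagon:
  "comp_mor ((A \<times>\<^sub>S B) \<times>\<^sub>S C) (assoc_mor B C A)
     (comp_mor ((A \<times>\<^sub>S B) \<times>\<^sub>S C) (swap_mor A (B \<times>\<^sub>S C)) (assoc_mor A B C)) =
   comp_mor ((A \<times>\<^sub>S B) \<times>\<^sub>S C) (prod_mor B (A \<times>\<^sub>S C) (id_mor B) (swap_mor A C))
     (comp_mor ((A \<times>\<^sub>S B) \<times>\<^sub>S C) (assoc_mor B A C)
        (prod_mor (A \<times>\<^sub>S B) C (swap_mor A B) (id_mor C)))"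
  by (auto simp: comp_mor_def compose_def structure_mor_defs fun_eq_iff)

end

theory Submission
  imports Defs
begin

text \<open>
  The degree of a skeleton can be read off at any single site \<open>z\<close>, as \<open>\<kappa> z * \<kappa> (\<sigma> z)\<close>; it is well
  defined because there is a site and the product is the same at all of them. A morphism takes
  \<open>z\<close> and \<open>\<sigma> z\<close> to a site of the target and its partner, with the same two weights, so it cannot
  change the degree (\<open>hom_degree_eq\<close>). In a Cartesian product the weights at \<open>(z, w)\<close> and at its
  partner multiply to the product of the two degrees (\<open>prod_degree\<close>), and the only site of the
  unit gives \<open>1 * 1\<close>. Functoriality of the product is an identity at each site, and it passes to the
  pieces of fixed degree because these are full subcategories.
\<close>

lemma has_degree_degree:
  assumes "E \<in> SDS"
  shows "has_degree E (degree E)"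
proof -
  obtain K where "has_degree E K" using assms by (auto simp: SDS_def)
  then show ?thesis using degree_eqI[OF assms] by simp
qed

lemma degree_pos: "E \<in> SDS \<Longrightarrow> degree E > 0"
  using has_degree_degree by (auto simp: has_degree_def)

lemma degree_at_site:
  "E \<in> SDS \<Longrightarrow> z \<in> sites E \<Longrightarrow> weight E z * weight E (invol E z) = degree E"
  using has_degree_degree by (auto simp: has_degree_def)

lemma SDS_eq_Union_SDS_deg: "SDS = (\<Union>K\<in>{0<..}. SDS_deg K)"
  by (auto simp: SDS_deg_def degree_pos)

text \<open>
  A skeleton has a site, so a morphism out of it hits some site of the target; the target's degree
  is computed there with the weights of the source.
\<close>

lemma hom_degree_eq:
  assumes "E \<in> SDS" "F \<in> SDS" "\<phi> \<in> hom E F"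
  shows "degree E = degree F"
proof -
  obtain z where z: "z \<in> sites E" using assms(1) by (auto simp: SDS_def)
  have "degree E = weight E z * weight E (invol E z)"
    using degree_at_site[OF assms(1) z] by simp
  also have "\<dots> = weight F (\<phi> z) * weight F (invol F (\<phi> z))"
    using assms(3) z invol_closed[OF assms(1) z] by (simp add: hom_def)
  also have "\<dots> = degree F"
    using degree_at_site[OF assms(2) hom_closed[OF assms(3) z]] .
  finally show ?thesis .
qed

lemma prod_degree:
  assumes "E \<in> SDS" "F \<in> SDS"
  shows "degree (E \<times>\<^sub>S F) = degree E * degree F"
  using assms by (intro degree_eqI prod_SDS has_degree_prod has_degree_degree)

lemma unit_SDS_deg: "unit_skel \<in> SDS_deg 1"
  using degree_at_site[OF unit_SDS, of "()"] unit_SDS by (simp add: SDS_deg_def unit_skel_def)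

lemma prod_mor_hom:
  assumes "E \<in> SDS" "E' \<in> SDS" "\<phi> \<in> hom E F" "\<phi>' \<in> hom E' F'"
  shows "prod_mor E E' \<phi> \<phi>' \<in> hom (E \<times>\<^sub>S E') (F \<times>\<^sub>S F')"
proof -
  have "\<phi> z \<in> sites F" "\<phi> (invol E z) = invol F (\<phi> z)" "weight E z = weight F (\<phi> z)"
    if "z \<in> sites E" for z
    using assms(3) that by (auto simp: hom_def)
  moreover have "\<phi>' z \<in> sites F'" "\<phi>' (invol E' z) = invol F' (\<phi>' z)" "weight E' z = weight F' (\<phi>' z)"
    if "z \<in> sites E'" for z
    using assms(4) that by (auto simp: hom_def)
  ultimately show ?thesis
    using assms(1,2) by (auto simp: hom_def prod_mor_def prod_skel_def invol_closed)
qed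

lemma prod_mor_id: "prod_mor E F (id_mor E) (id_mor F) = id_mor (E \<times>\<^sub>S F)"
  by (auto simp: prod_mor_def id_mor_def fun_eq_iff)

lemma prod_mor_comp:
  assumes "\<phi> \<in> hom E F" "\<phi>' \<in> hom E' F'"
  shows "prod_mor E E' (comp_mor E \<psi> \<phi>) (comp_mor E' \<psi>' \<phi>') =
         comp_mor (E \<times>\<^sub>S E') (prod_mor F F' \<psi> \<psi>') (prod_mor E E' \<phi> \<phi>')"
  using assms by (auto simp: comp_mor_def compose_def prod_mor_def hom_closed fun_eq_iff)

theorem corollary6p4:
  shows
    \<comment> \<open>\<open>SDS\<close> is graded by the positive reals: it is the union of the pieces of degree \<open>K > 0\<close>\<close>
    "(SDS :: 'a skeleton set) = (\<Union>K\<in>{0<..}. SDS_deg K) \<and>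
    \<comment> \<open>(1) the product is a functor from pieces of degrees \<open>K1\<close>, \<open>K2\<close> to that of degree \<open>K1 * K2\<close>\<close>
    (\<forall>K1>0. \<forall>K2>0.
      (\<forall>(E1 :: 'a skeleton) \<in> SDS_deg K1. \<forall>(E2 :: 'd skeleton) \<in> SDS_deg K2.
         E1 \<times>\<^sub>S E2 \<in> SDS_deg (K1 * K2) \<and>
         prod_mor E1 E2 (id_mor E1) (id_mor E2) = id_mor (E1 \<times>\<^sub>S E2)) \<and>
      (\<forall>(E1 :: 'a skeleton) \<in> SDS_deg K1. \<forall>(F1 :: 'b skeleton) \<in> SDS_deg K1.
       \<forall>(E2 :: 'd skeleton) \<in> SDS_deg K2. \<forall>(F2 :: 'e skeleton) \<in> SDS_deg K2.
       \<forall>\<phi>1 \<in> hom E1 F1. \<forall>\<phi>2 \<in> hom E2 F2.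
         prod_mor E1 E2 \<phi>1 \<phi>2 \<in> hom (E1 \<times>\<^sub>S E2) (F1 \<times>\<^sub>S F2)) \<and>
      (\<forall>(E1 :: 'a skeleton) \<in> SDS_deg K1. \<forall>(F1 :: 'b skeleton) \<in> SDS_deg K1.
       \<forall>(G1 :: 'c skeleton) \<in> SDS_deg K1.
       \<forall>(E2 :: 'd skeleton) \<in> SDS_deg K2. \<forall>(F2 :: 'e skeleton) \<in> SDS_deg K2.
       \<forall>(G2 :: 'f skeleton) \<in> SDS_deg K2.
       \<forall>\<phi>1 \<in> hom E1 F1. \<forall>\<psi>1 \<in> hom F1 G1. \<forall>\<phi>2 \<in> hom E2 F2. \<forall>\<psi>2 \<in> hom F2 G2.
         prod_mor E1 E2 (comp_mor E1 \<psi>1 \<phi>1) (comp_mor E2 \<psi>2 \<phi>2) =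
         comp_mor (E1 \<times>\<^sub>S E2) (prod_mor F1 F2 \<psi>1 \<psi>2) (prod_mor E1 E2 \<phi>1 \<phi>2))) \<and>
    \<comment> \<open>(2) morphisms preserve the degree, hence the product of morphisms respects the grading\<close>
    (\<forall>(E1 :: 'a skeleton) \<in> SDS. \<forall>(F1 :: 'b skeleton) \<in> SDS.
       hom E1 F1 \<noteq> {} \<longrightarrow> degree E1 = degree F1) \<and>
    (\<forall>(E1 :: 'a skeleton) \<in> SDS. \<forall>(F1 :: 'b skeleton) \<in> SDS.
     \<forall>(E2 :: 'd skeleton) \<in> SDS. \<forall>(F2 :: 'e skeleton) \<in> SDS.
     \<forall>\<phi>1 \<in> hom E1 F1. \<forall>\<phi>2 \<in> hom E2 F2.
       prod_mor E1 E2 \<phi>1 \<phi>2 \<in> hom (E1 \<times>\<^sub>S E2) (F1 \<times>\<^sub>S F2) \<and>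
       E1 \<times>\<^sub>S E2 \<in> SDS_deg (degree E1 * degree E2) \<and>
       F1 \<times>\<^sub>S F2 \<in> SDS_deg (degree E1 * degree E2)) \<and>
    \<comment> \<open>(3) the unit has degree \<open>1\<close>\<close>
    unit_skel \<in> SDS_deg 1"
proof (intro conjI allI ballI impI)
  show "(SDS :: 'a skeleton set) = (\<Union>K\<in>{0<..}. SDS_deg K)"
    by (rule SDS_eq_Union_SDS_deg)
  show "unit_skel \<in> SDS_deg 1" by (rule unit_SDS_deg)
next
  fix E1 :: "'a skeleton" and F1 :: "'b skeleton" and E2 :: "'d skeleton" and F2 :: "'e skeleton"
    and \<phi>1 \<phi>2
  assume SDS: "E1 \<in> SDS" "F1 \<in> SDS" "E2 \<in> SDS" "F2 \<in> SDS"
    and hom: "\<phi>1 \<in> hom E1 F1" "\<phi>2 \<in> hom E2 F2"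
  show "F1 \<times>\<^sub>S F2 \<in> SDS_deg (degree E1 * degree E2)"
    using SDS hom hom_degree_eq[of E1 F1] hom_degree_eq[of E2 F2]
    by (simp add: SDS_deg_def prod_SDS prod_degree)
qed (auto simp: SDS_deg_def prod_SDS prod_degree prod_mor_id prod_mor_hom prod_mor_comp
       dest: hom_degree_eq)

end
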